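(* Let $\kappa>0$ be a real number that is not divisible by three (i.e. not an integer multiple of $3$), and for $x\in\mathbb{R}^d$ let $g(x)=\mathrm{SCAD}(x)-\kappa=\sum_{i=1}^ds(x_i)-\kappa$, where $$s(z)=\begin{cases}2|z|&0\le|z|\le1,\\-z^2+4|z|-1&1<|z|\le2,\\3&|z|>2.\end{cases}$$ Let $\rho\ge0$ be such that the objective function $f$ and the constraint function $g$ are both $\rho$-weakly convex on $\mathbb{R}^d$. Then the following hold. 1. There exists a non-negative integer $k$ such that $\kappa\in(3k,3(k+1))$. 2. With $\mathcal{Z}=(-\infty,-2]\cup\{0\}\cup[2,\infty)$, $$\underline q:=\inf\Big\{\max_i\mathrm{dist}(x_i,\mathcal{Z})\ :\ \mathrm{SCAD}(x)\in\big[(\kappa+3k)/2,\ (\kappa+3(k+1))/2\big]\Big\}>0.$$ 3. For any $\bar\rho>\rho$ and any $\bar\epsilon>0$ with $$\bar\epsilon^2\le\min\left\{\frac{3(k+1)-\kappa}2,\ \frac{\underline q^2}{2+\bar\rho},\ \frac{\underline q^3}2\right\},$$ setting $$\theta:=\min\left\{\frac{\kappa-3k}2,\ \frac{\underline q^2}{2+\bar\rho},\ \frac{\underline q^3}2\right\},$$ one has: for every $x\in\mathbb{R}^d$ with $g(x)\le\bar\epsilon^2$ there exists $y\in\mathbb{R}^d$ with $g(y)+\frac{\bar\rho}2\|y-x\|^2\le-\theta$.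
   Context: $\|\cdot\|$ is the Euclidean norm and $\mathrm{dist}(z,\mathcal{Z})=\min_{w\in\mathcal{Z}}|z-w|$. The infimum of the empty set is $+\infty$. A function $h$ is $\rho$-weakly convex on $\mathbb{R}^d$ ($\rho\ge0$) if $h(x)\ge h(x')+\langle\zeta,x-x'\rangle-\frac\rho2\|x-x'\|^2$ for all $x,x'$ and all $\zeta\in\partial h(x')$, where $\partial h(x')=\{\zeta: h(x)\ge h(x')+\langle\zeta,x-x'\rangle+o(\|x-x'\|),\ x\to x'\}$. The setting is the problem of minimizing a training loss $f$ over $\mathbb{R}^d$ subject to the sparsity-promoting SCAD constraint $g(x)\le0$. The conclusion of item 3 is the "uniform Slater's condition" for the constraint with parameters $\bar\epsilon,\theta,\bar\rho$. *)

theory Defs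
  imports "HOL-Analysis.Analysis" "HOL-Library.Landau_Symbols"
begin

text \<open>The regular (Frechet) subdifferential of \<open>h\<close> at \<open>x'\<close>; \<open>r\<close> is the remainder term
  \<open>o(norm (x - x'))\<close> as \<open>x\<close> tends to \<open>x'\<close>.\<close>

definition subdifferential :: "('a::real_inner \<Rightarrow> real) \<Rightarrow> 'a \<Rightarrow> 'a set" where
  "subdifferential h x' =
     {\<zeta>. \<exists>r \<in> o[at x'](\<lambda>x. norm (x - x')).
        \<forall>\<^sub>F x in at x'. h x \<ge> h x' + \<zeta> \<bullet> (x - x') + r x}"

definition weakly_convex :: "real \<Rightarrow> ('a::real_inner \<Rightarrow> real) \<Rightarrow> bool" where
  "weakly_convex \<rho> h \<longleftrightarrow>
     (\<forall>x x'. \<forall>\<zeta> \<in> subdifferential h x'.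
        h x \<ge> h x' + \<zeta> \<bullet> (x - x') - \<rho> / 2 * (norm (x - x'))\<^sup>2)"

definition scad1 :: "real \<Rightarrow> real" where
  "scad1 z =
     (if \<bar>z\<bar> \<le> 1 then 2 * \<bar>z\<bar>
      else if \<bar>z\<bar> \<le> 2 then - z\<^sup>2 + 4 * \<bar>z\<bar> - 1
      else 3)"

definition SCAD :: "real ^ 'n::finite \<Rightarrow> real" where
  "SCAD x = (\<Sum>i\<in>UNIV. scad1 (x $ i))"

definition scad_constraint :: "real \<Rightarrow> real ^ 'n::finite \<Rightarrow> real" where
  "scad_constraint \<kappa> x = SCAD x - \<kappa>"

definition flat_set :: "real set" where
  "flat_set = {..-2} \<union> {0} \<union> {2..}"

text \<open>The infimum is taken in the extended reals, so that it is \<open>\<infinity>\<close> when no \<open>x\<close> satisfies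
  the constraint; this does happen, namely for \<open>\<kappa>\<close> large compared with the dimension. The dimension
  enters only through the type \<open>'n\<close>, which is therefore an explicit argument. As \<open>flat_set\<close> is
  closed and nonempty, \<open>infdist\<close> is an attained minimum.\<close>

definition q_low :: "'n::finite itself \<Rightarrow> real \<Rightarrow> nat \<Rightarrow> ereal" where
  "q_low _ \<kappa> k =
     (INF x \<in> {x :: real ^ 'n.
                SCAD x \<in> {(\<kappa> + 3 * real k) / 2 .. (\<kappa> + 3 * (real k + 1)) / 2}}.
        ereal (Max (range (\<lambda>i. infdist (x $ i) flat_set))))"

end

(*
  SCAD takes only multiples of 3 on vectors with all entries in flat_set and is Lipschitz around
  such vectors, so a value strictly between 3k and 3(k+1) forces some entry to be at a definite
  distance q from flat_set. Such an entry has modulus in [q, 2 - q], and scad1, as a function of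
  the modulus, has slope at least 2q on [0, 2 - q]; moving it towards 0 by t = 2q / (2 + \<rho>') gains
  2qt - (\<rho>' / 2) t^2 \<ge> 2 q^2 / (2 + \<rho>'), which pays for both \<epsilon>^2 and \<theta>.
*)

theory Submission
  imports Defs
begin

text \<open>Completing the square in two ways writes the middle piece as
  \<open>2 * |z| - (|z| - 1)^2\<close> and as \<open>3 - (2 - |z|)^2\<close>. The first form serves
  \<open>w = 0\<close>, where \<open>scad1\<close> is 0, the second serves \<open>|w| >= 2\<close>,
  where it is 3.\<close>

lemma scad1_near_flat:
  assumes "w \<in> flat_set"
  obtains "\<bar>scad1 z\<bar> \<le> 2 * \<bar>z - w\<bar>" | "\<bar>scad1 z - 3\<bar> \<le> 2 * \<bar>z - w\<bar>"
proof -
  have "\<bar>scad1 z\<bar> \<le> 2 * \<bar>z\<bar>"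
  proof -
    have "- z\<^sup>2 + 4 * \<bar>z\<bar> - 1 = 2 * \<bar>z\<bar> - (\<bar>z\<bar> - 1)\<^sup>2"
      by (simp add: power2_eq_square algebra_simps)
    moreover have "\<bar>z\<bar> > 1 \<Longrightarrow> \<bar>z\<bar> \<le> 2 \<Longrightarrow> (\<bar>z\<bar> - 1)\<^sup>2 \<le> 1"
      by (simp add: power_le_one)
    moreover have "(\<bar>z\<bar> - 1)\<^sup>2 \<ge> 0"
      by simp
    ultimately show ?thesis
      unfolding scad1_def by (smt (verit))
  qed
  moreover have "\<bar>scad1 z - 3\<bar> \<le> 2 * \<bar>z - w\<bar>" if "\<bar>w\<bar> \<ge> 2"
  proof -
    have "- z\<^sup>2 + 4 * \<bar>z\<bar> - 1 = 3 - (2 - \<bar>z\<bar>)\<^sup>2"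
      by (simp add: power2_eq_square algebra_simps)
    \<comment> \<open>Here \<open>2 - |z|\<close> lies in [0, 1), and it is at most
      \<open>|z - w|\<close> because \<open>|w| >= 2\<close>.\<close>
    moreover have "(2 - \<bar>z\<bar>)\<^sup>2 \<le> 2 - \<bar>z\<bar>" if "\<bar>z\<bar> > 1" "\<bar>z\<bar> \<le> 2"
      using that mult_left_le[of "2 - \<bar>z\<bar>" "2 - \<bar>z\<bar>"] by (simp add: power2_eq_square)
    moreover have "(2 - \<bar>z\<bar>)\<^sup>2 \<ge> 0"
      by simp
    ultimately show ?thesis
      using that unfolding scad1_def by (smt (verit))
  qed
  ultimately show ?thesis
    using assms that unfolding flat_set_def by fastforce
qed

text \<open>The multiplier is 0 or 1 according to the flat point nearest to \<open>z\<close>; hiding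
  it behind an existential lets the entries of a vector be summed without a case split.\<close>

lemma scad1_near_flat_infdist:
  "\<exists>m::nat. \<bar>scad1 z - 3 * real m\<bar> \<le> 2 * infdist z flat_set"
proof -
  have "closed flat_set" "flat_set \<noteq> {}"
    unfolding flat_set_def by (intro closed_Un closed_atMost closed_atLeast closed_singleton) auto
  then obtain w where w: "w \<in> flat_set" "infdist z flat_set = dist z w"
    using infdist_attains_inf by metis
  show ?thesis
    using w(1)
  proof (cases rule: scad1_near_flat[of w z])
    case 1
    then show ?thesis
      using w(2) by (intro exI[of _ 0]) (simp add: dist_real_def)
  next
    case 2
    then show ?thesis
      using w(2) by (intro exI[of _ 1]) (simp add: dist_real_def)
  qed
qed

lemma SCAD_near_flat:
  fixes x :: "real ^ 'n::finite"
  assumes "\<And>i. infdist (x $ i) flat_set \<le> e"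
  shows "\<exists>N::nat. \<bar>SCAD x - 3 * real N\<bar> \<le> 2 * real CARD('n) * e"
proof -
  have "\<forall>i. \<exists>m::nat. \<bar>scad1 (x $ i) - 3 * real m\<bar> \<le> 2 * infdist (x $ i) flat_set"
    by (intro allI scad1_near_flat_infdist)
  from choice[OF this] obtain m :: "'n \<Rightarrow> nat"
    where m: "\<And>i. \<bar>scad1 (x $ i) - 3 * real (m i)\<bar> \<le> 2 * infdist (x $ i) flat_set"
    by blast
  have "SCAD x - 3 * real (\<Sum>i\<in>UNIV. m i) = (\<Sum>i\<in>UNIV. scad1 (x $ i) - 3 * real (m i))"
    by (simp add: SCAD_def sum_subtractf sum_distrib_left)
  also have "\<bar>\<dots>\<bar> \<le> (\<Sum>i\<in>(UNIV::'n set). 2 * e)"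
    by (rule order_trans[OF sum_abs], rule sum_mono) (smt (verit) m assms)
  finally show ?thesis
    by (intro exI[of _ "\<Sum>i\<in>UNIV. m i"]) (simp add: algebra_simps)
qed

lemma q_low_pos:
  assumes "\<kappa> \<in> {3 * real k <..< 3 * (real k + 1)}"
  shows "q_low TYPE('n::finite) \<kappa> k > 0"
proof -
  \<comment> \<open>The admissible values of \<open>SCAD\<close> lie between the midpoints of
    \<open>3k\<close>, \<kappa> and of \<kappa>, \<open>3(k + 1)\<close>, so \<delta> bounds from
    below their distance to every multiple of 3.\<close>
  define \<delta> where "\<delta> = min ((\<kappa> - 3 * real k) / 2) ((3 * (real k + 1) - \<kappa>) / 2)"
  \<comment> \<open>Dividing by the constant of \<open>SCAD_near_flat\<close> gives a bound
    independent of \<open>x\<close>, which therefore passes to the infimum, also when no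
    \<open>x\<close> is admissible.\<close>
  define c where "c = \<delta> / (2 * real CARD('n))"
  have "c > 0"
    using assms by (simp add: c_def \<delta>_def)
  have "c \<le> Max (range (\<lambda>i. infdist (x $ i) flat_set))"
    if x: "SCAD x \<in> {(\<kappa> + 3 * real k) / 2 .. (\<kappa> + 3 * (real k + 1)) / 2}" for x :: "real ^ 'n"
  proof -
    let ?M = "Max (range (\<lambda>i. infdist (x $ i) flat_set))"
    obtain N :: nat where N: "\<bar>SCAD x - 3 * real N\<bar> \<le> 2 * real CARD('n) * ?M"
      using SCAD_near_flat[of x ?M] by auto
    have "N \<le> k \<or> real N \<ge> real k + 1"
      by linarith
    then have "\<delta> \<le> \<bar>SCAD x - 3 * real N\<bar>"
    proof
      assume "N \<le> k"
      then have "real N \<le> real k" by simp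
      with x have "(\<kappa> - 3 * real k) / 2 \<le> SCAD x - 3 * real N"
        by (simp add: field_simps)
      then show ?thesis
        unfolding \<delta>_def by linarith
    next
      assume "real N \<ge> real k + 1"
      with x have "(3 * (real k + 1) - \<kappa>) / 2 \<le> 3 * real N - SCAD x"
        by (simp add: field_simps)
      then show ?thesis
        unfolding \<delta>_def by linarith
    qed
    with N show ?thesis
      by (simp add: c_def field_simps)
  qed
  then have "ereal c \<le> q_low TYPE('n) \<kappa> k"
    unfolding q_low_def by (intro INF_greatest) auto
  with \<open>c > 0\<close> show ?thesis
    by (metis ereal_less(2) less_le_trans)
qed

lemma infdist_flat_set_ge:
  assumes "r > 0" "r \<le> infdist z flat_set"
  shows "r \<le> \<bar>z\<bar>" "\<bar>z\<bar> \<le> 2 - r"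
proof -
  have d: "r \<le> \<bar>z - w\<bar>" if "w \<in> flat_set" for w
    using infdist_le[OF that, of z] assms(2) by (simp add: dist_real_def)
  show "r \<le> \<bar>z\<bar>"
    using d[of 0] by (simp add: flat_set_def)
  \<comment> \<open>This puts \<open>z\<close> strictly between -2 and 2, so that its distances to
    these two points are \<open>2 - z\<close> and \<open>2 + z\<close>.\<close>
  have "z \<notin> flat_set"
    using d[of z] assms(1) by auto
  then show "\<bar>z\<bar> \<le> 2 - r"
    using d[of 2] d[of "-2"] by (auto simp: flat_set_def)
qed

text \<open>In terms of the modulus \<open>a\<close>, the slope is 2 up to 1 and
  \<open>4 - 2 * a\<close> from 1 to 2; both are at least \<open>2 * q\<close> when
  \<open>a <= 2 - q\<close>, as the hypotheses force \<open>q <= 1\<close>. Since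
  \<open>t <= q <= a\<close>, the move does not cross 0 and lowers the modulus by exactly
  \<open>t\<close>.\<close>

lemma scad1_descent:
  assumes "0 \<le> t" "t \<le> q" "q \<le> \<bar>z\<bar>" "\<bar>z\<bar> \<le> 2 - q"
  shows "scad1 (z - sgn z * t) + 2 * q * t \<le> scad1 z"
proof -
  define a where "a = \<bar>z\<bar>"
  have a: "\<bar>z - sgn z * t\<bar> = a - t" and "t \<le> a" "q \<le> 1" "a \<le> 2 - q" "q \<ge> 0"
    using assms by (auto simp: a_def sgn_real_def abs_if)
  have sq: "(z - sgn z * t)\<^sup>2 = (a - t)\<^sup>2" "z\<^sup>2 = a\<^sup>2"
    using a by (metis power2_abs, simp add: a_def)
  have unf: "scad1 (z - sgn z * t) =
      (if a - t \<le> 1 then 2 * (a - t) else if a - t \<le> 2 then - (a - t)\<^sup>2 + 4 * (a - t) - 1 else 3)"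
    "scad1 z = (if a \<le> 1 then 2 * a else if a \<le> 2 then - a\<^sup>2 + 4 * a - 1 else 3)"
    unfolding scad1_def a sq a_def[symmetric] by simp_all
  have *: "q * t \<le> t"
    using mult_right_mono[OF \<open>q \<le> 1\<close> \<open>0 \<le> t\<close>] by simp
  consider "a \<le> 1" | "a > 1" "a - t \<le> 1" | "a - t > 1"
    by linarith
  then show ?thesis
  proof cases
    case 1
    then show ?thesis
      using assms(1) * by (simp add: unf)
  next
    case 2
    \<comment> \<open>The move crosses the breakpoint 1. The quadratic piece lies
      \<open>(a - 1)^2\<close> below the line \<open>2 * a\<close>; one factor \<open>a - 1\<close>
      is at most \<open>t\<close>, the other at most \<open>1 - q\<close>.\<close>
    have "(a - 1) * (a - 1) \<le> t * (1 - q)"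
      using 2 \<open>a \<le> 2 - q\<close> \<open>0 \<le> t\<close> by (intro mult_mono) auto
    moreover have "0 \<le> (a - 1) * (a - 1)"
      by simp
    ultimately have "(a - 1)\<^sup>2 + 2 * q * t \<le> 2 * t"
      by (simp add: power2_eq_square algebra_simps)
    then show ?thesis
      using 2 \<open>a \<le> 2 - q\<close> \<open>q \<ge> 0\<close> unfolding unf by (simp add: power2_eq_square algebra_simps)
  next
    case 3
    \<comment> \<open>Both points lie on the quadratic piece, where the decrease is exactly
      \<open>t * (4 - 2 * a + t)\<close>.\<close>
    have "0 \<le> t * (4 - 2 * a + t - 2 * q)"
      using \<open>a \<le> 2 - q\<close> \<open>0 \<le> t\<close> by (intro mult_nonneg_nonneg) auto
    then show ?thesis
      using 3 \<open>a \<le> 2 - q\<close> \<open>q \<ge> 0\<close> \<open>0 \<le> t\<close> unfolding unf by (simp add: power2_eq_square algebra_simps)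
  qed
qed

lemma SCAD_descent:
  fixes x :: "real ^ 'n::finite"
  assumes "\<rho> \<ge> 0" "q \<ge> 0" "q \<le> \<bar>x $ i\<bar>" "\<bar>x $ i\<bar> \<le> 2 - q"
  shows "\<exists>y. SCAD y + \<rho> / 2 * (norm (y - x))\<^sup>2 + 2 * (q\<^sup>2 / (2 + \<rho>)) \<le> SCAD x"
proof -
  \<comment> \<open>The unconstrained maximiser of \<open>2 * q * t - \<rho> / 2 * t^2\<close> would
    be \<open>2 * q / \<rho>\<close>; the extra 2 in the denominator guarantees
    \<open>t <= q\<close> and covers \<open>\<rho> = 0\<close>.\<close>
  define t where "t = 2 * q / (2 + \<rho>)"
  have t: "0 \<le> t" "t \<le> q"
    using assms(1,2) mult_nonneg_nonneg[of \<rho> q] by (auto simp: t_def field_simps)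
  define y where "y = x - (sgn (x $ i) * t) *\<^sub>R axis i 1"
  have "SCAD x - SCAD y = (\<Sum>j\<in>UNIV. scad1 (x $ j) - scad1 (y $ j))"
    by (simp add: SCAD_def sum_subtractf)
  also have "\<dots> = (\<Sum>j\<in>UNIV. if j = i then scad1 (x $ i) - scad1 (x $ i - sgn (x $ i) * t) else 0)"
    by (intro sum.cong) (auto simp: y_def axis_def)
  also have "\<dots> \<ge> 2 * q * t"
    using scad1_descent[OF t assms(3,4)] by simp
  finally have gain: "SCAD y + 2 * q * t \<le> SCAD x"
    by simp
  have "norm (y - x) \<le> t"
    using t(1) by (simp add: y_def abs_mult sgn_real_def)
  then have "\<rho> / 2 * (norm (y - x))\<^sup>2 \<le> \<rho> / 2 * t\<^sup>2"
    using assms(1) by (intro mult_left_mono power_mono) auto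
  moreover have "(2 + \<rho>) * t = 2 * q"
    using assms(1) by (simp add: t_def)
  \<comment> \<open>Multiplying the previous equation by \<open>t / 2\<close> gives
    \<open>t^2 + \<rho> / 2 * t^2 = q * t\<close>: half of the gain covers the quadratic penalty,
    and the other half is the claimed surplus.\<close>
  then have "2 * q * t = t\<^sup>2 + \<rho> / 2 * t\<^sup>2 + q * t"
    by algebra
  moreover have "q * t = 2 * (q\<^sup>2 / (2 + \<rho>))"
    by (simp add: t_def power2_eq_square)
  ultimately show ?thesis
    using gain zero_le_power2[of t] by (intro exI[of _ y]) linarith
qed

text \<open>An admissible \<open>x\<close> makes the infimum finite, and \<open>q_low_pos\<close>
  makes it positive, so it is a real number; the entry attaining the maximum for \<open>x\<close> is
  at least that far from \<open>flat_set\<close>.\<close>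

lemma q_low_witness:
  fixes x :: "real ^ 'n::finite"
  assumes "\<kappa> \<in> {3 * real k <..< 3 * (real k + 1)}"
    and "SCAD x \<in> {(\<kappa> + 3 * real k) / 2 .. (\<kappa> + 3 * (real k + 1)) / 2}"
  obtains r i where "q_low TYPE('n) \<kappa> k = ereal r" "r > 0" "r \<le> infdist (x $ i) flat_set"
proof -
  have "Max (range (\<lambda>i. infdist (x $ i) flat_set)) \<in> range (\<lambda>i. infdist (x $ i) flat_set)"
    by (intro Max_in) auto
  then obtain i where "Max (range (\<lambda>i. infdist (x $ i) flat_set)) = infdist (x $ i) flat_set"
    by blast
  then have "q_low TYPE('n) \<kappa> k \<le> ereal (infdist (x $ i) flat_set)"
    unfolding q_low_def using assms(2) by (metis (mono_tags, lifting) INF_lower mem_Collect_eq)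
  moreover have "q_low TYPE('n) \<kappa> k > 0"
    by (rule q_low_pos[OF assms(1)])
  ultimately show ?thesis
    by (cases "q_low TYPE('n) \<kappa> k") (auto intro: that)
qed

text \<open>Reduces the extended-real conclusion to a real inequality, with \<open>b\<close> a
  finite upper bound of \<theta> such as a member of the minimum defining it.\<close>

lemma ereal_le_uminusI:
  assumes "\<theta> \<le> ereal b" "b \<le> - a"
  shows "ereal a \<le> - \<theta>"
  using assms by (cases \<theta>) auto

theorem propositionB2:
  fixes \<kappa> \<rho> :: real and f :: "real ^ 'n::finite \<Rightarrow> real"
  assumes "\<kappa> > 0"
    and "\<not> (\<exists>m::int. \<kappa> = 3 * of_int m)"
    and "\<rho> \<ge> 0"
    and "weakly_convex \<rho> f"
    and "weakly_convex \<rho> (scad_constraint \<kappa> :: real ^ 'n \<Rightarrow> real)"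
  shows "(\<exists>k::nat. \<kappa> \<in> {3 * real k <..< 3 * (real k + 1)}) \<and>
    (\<forall>k::nat. \<kappa> \<in> {3 * real k <..< 3 * (real k + 1)} \<longrightarrow>
      (let q = q_low TYPE('n) \<kappa> k in
        q > 0 \<and>
        (\<forall>\<rho>' > \<rho>. \<forall>\<epsilon> > 0.
          ereal (\<epsilon>\<^sup>2) \<le> Min {ereal ((3 * (real k + 1) - \<kappa>) / 2), q\<^sup>2 / ereal (2 + \<rho>'), q ^ 3 / 2} \<longrightarrow>
          (let \<theta> = Min {ereal ((\<kappa> - 3 * real k) / 2), q\<^sup>2 / ereal (2 + \<rho>'), q ^ 3 / 2} in
            \<forall>x :: real ^ 'n. scad_constraint \<kappa> x \<le> \<epsilon>\<^sup>2 \<longrightarrow>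
              (\<exists>y :: real ^ 'n.
                ereal (scad_constraint \<kappa> y + \<rho>' / 2 * (norm (y - x))\<^sup>2) \<le> - \<theta>)))))"
proof (intro conjI allI impI)
  \<comment> \<open>Positivity of \<kappa> makes the floor nonnegative, and the divisibility
    hypothesis excludes the left endpoint \<open>3k\<close>.\<close>
  define k where "k = nat \<lfloor>\<kappa> / 3\<rfloor>"
  have k: "real k = of_int \<lfloor>\<kappa> / 3\<rfloor>"
    using assms(1) by (simp add: k_def)
  then have "\<kappa> \<noteq> 3 * real k"
    using assms(2) by metis
  moreover have "real k \<le> \<kappa> / 3" "\<kappa> / 3 < real k + 1"
    unfolding k by linarith+
  ultimately have "\<kappa> \<in> {3 * real k <..< 3 * (real k + 1)}"
    by (auto simp: field_simps)
  then show "\<exists>k::nat. \<kappa> \<in> {3 * real k <..< 3 * (real k + 1)}" ..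
next
  fix k :: nat
  assume k: "\<kappa> \<in> {3 * real k <..< 3 * (real k + 1)}"
  define q where "q = q_low TYPE('n) \<kappa> k"
  have "\<exists>y :: real ^ 'n. ereal (scad_constraint \<kappa> y + \<rho>' / 2 * (norm (y - x))\<^sup>2)
      \<le> - Min {ereal ((\<kappa> - 3 * real k) / 2), q\<^sup>2 / ereal (2 + \<rho>'), q ^ 3 / 2}"
    (is "\<exists>y. _ \<le> - ?\<theta>")
    if "\<rho>' > \<rho>"
      and eps: "ereal (\<epsilon>\<^sup>2) \<le> Min {ereal ((3 * (real k + 1) - \<kappa>) / 2), q\<^sup>2 / ereal (2 + \<rho>'), q ^ 3 / 2}"
      and x: "scad_constraint \<kappa> x \<le> \<epsilon>\<^sup>2"
    for \<rho>' \<epsilon> :: real and x :: "real ^ 'n"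
  proof (cases "SCAD x < (\<kappa> + 3 * real k) / 2")
    \<comment> \<open>Below the admissible range \<open>x\<close> already has enough slack, so
      \<open>y = x\<close> works with no penalty.\<close>
    case True
    have "?\<theta> \<le> ereal ((\<kappa> - 3 * real k) / 2)"
      by simp
    moreover have "(\<kappa> - 3 * real k) / 2 \<le> - (scad_constraint \<kappa> x + \<rho>' / 2 * (norm (x - x))\<^sup>2)"
      using True by (simp add: scad_constraint_def field_simps)
    ultimately show ?thesis
      by (intro exI[of _ x] ereal_le_uminusI)
  next
    case False
    \<comment> \<open>This bound keeps \<open>SCAD x\<close>, which is at most
      \<open>\<kappa> + \<epsilon>^2\<close>, below the upper end of the admissible range.\<close>
    have "\<epsilon>\<^sup>2 \<le> (3 * (real k + 1) - \<kappa>) / 2"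
      using eps by simp
    with x False have "SCAD x \<in> {(\<kappa> + 3 * real k) / 2 .. (\<kappa> + 3 * (real k + 1)) / 2}"
      by (simp add: scad_constraint_def field_simps)
    then obtain r i where r: "q = ereal r" "r > 0" "r \<le> infdist (x $ i) flat_set"
      using q_low_witness[OF k] unfolding q_def by metis
    have "\<rho>' > 0"
      using assms(3) \<open>\<rho>' > \<rho>\<close> by simp
    then have qq: "q\<^sup>2 / ereal (2 + \<rho>') = ereal (r\<^sup>2 / (2 + \<rho>'))"
      using r(1) by simp
    obtain y where y: "SCAD y + \<rho>' / 2 * (norm (y - x))\<^sup>2 + 2 * (r\<^sup>2 / (2 + \<rho>')) \<le> SCAD x"
      using SCAD_descent infdist_flat_set_ge[OF r(2,3)] \<open>\<rho>' > 0\<close> r(2) by (metis less_imp_le)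
    \<comment> \<open>One of the two copies of \<open>r^2 / (2 + \<rho>')\<close> gained at
      \<open>y\<close> offsets the violation \<epsilon>^2; the other remains as the margin and
      dominates \<theta>.\<close>
    have "\<epsilon>\<^sup>2 \<le> r\<^sup>2 / (2 + \<rho>')"
      using eps unfolding qq by simp
    with x y have "r\<^sup>2 / (2 + \<rho>') \<le> - (scad_constraint \<kappa> y + \<rho>' / 2 * (norm (y - x))\<^sup>2)"
      by (simp add: scad_constraint_def)
    moreover have "?\<theta> \<le> ereal (r\<^sup>2 / (2 + \<rho>'))"
      unfolding qq by (intro Min_le) auto
    ultimately show ?thesis
      by (intro exI[of _ y] ereal_le_uminusI)
  qed
  moreover have "q > 0"
    unfolding q_def by (rule q_low_pos[OF k])
  ultimately show "let q = q_low TYPE('n) \<kappa> k in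
        q > 0 \<and>
        (\<forall>\<rho>' > \<rho>. \<forall>\<epsilon> > 0.
          ereal (\<epsilon>\<^sup>2) \<le> Min {ereal ((3 * (real k + 1) - \<kappa>) / 2), q\<^sup>2 / ereal (2 + \<rho>'), q ^ 3 / 2} \<longrightarrow>
          (let \<theta> = Min {ereal ((\<kappa> - 3 * real k) / 2), q\<^sup>2 / ereal (2 + \<rho>'), q ^ 3 / 2} in
            \<forall>x :: real ^ 'n. scad_constraint \<kappa> x \<le> \<epsilon>\<^sup>2 \<longrightarrow>
              (\<exists>y :: real ^ 'n.
                ereal (scad_constraint \<kappa> y + \<rho>' / 2 * (norm (y - x))\<^sup>2) \<le> - \<theta>)))"
    unfolding Let_def q_def[symmetric] by blast
qed

end
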